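(* Let $\mathbb{E}$ be a (finite-dimensional) Euclidean space, let $f\in\Gamma_0(\mathbb{E})$ and fix $\bar x\in\mathbb{E}$. Define $\eta:\mathbb{R}\to\mathbb{R}\cup\{+\infty\}$ by $$\eta(\lambda)=\begin{cases}f(P_\lambda f(\bar x))&\text{if }\lambda>0,\\ f(P_{\mathrm{cl}(\mathrm{dom} f)}(\bar x))&\text{if }\lambda\le0.\end{cases}$$ Then the following hold: (a) $\eta$ is decreasing, continuous (possibly in an extended real-valued sense), and finite-valued if (and only if) $P_{\mathrm{cl}(\mathrm{dom} f)}(\bar x)=\bar x\in\mathrm{dom} f$. (b) $\eta$ is locally Lipschitz on $\mathbb{R}_{++}$. (c) If $\bar x\in\mathrm{dom}\,\partial f$, then the assertion in (b) holds on $\mathbb{R}$, i.e., $\eta$ is locally Lipschitz on $\mathbb{R}$.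
   Context: $\Gamma_0(\mathbb{E})$ denotes the closed proper convex functions $\mathbb{E}\to\mathbb{R}\cup\{+\infty\}$. For $\lambda>0$, $P_\lambda f(x)=\mathrm{argmin}_{u\in\mathbb{E}}\{f(u)+\frac1{2\lambda}\|x-u\|^2\}$. $P_C$ is the Euclidean projection onto a closed convex set $C$. $\mathrm{dom}\,\partial f=\{x\mid\partial f(x)\ne\emptyset\}$, where $\partial f$ is the convex subdifferential; $\mathbb{R}_{++}=(0,\infty)$. "Decreasing" is in the weak sense ($\lambda\le\mu$ implies $\eta(\lambda)\ge\eta(\mu)$).
   Formalization: The "only if" in (a) is false as printed (f the indicator of [0,1], x̄ = 2: η ≡ 0); proved instead: η is finite-valued if and only if P_{cl(dom f)}(x̄) ∈ dom f, alongside the printed "if" direction. *)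

theory Defs
  imports "HOL-Analysis.Analysis"
begin

definition epi :: "('a \<Rightarrow> ereal) \<Rightarrow> ('a \<times> real) set" where
  "epi f = {(x, r). f x \<le> ereal r}"

definition eff_dom :: "('a \<Rightarrow> ereal) \<Rightarrow> 'a set" where
  "eff_dom f = {x. f x < \<infinity>}"

definition proper :: "('a \<Rightarrow> ereal) \<Rightarrow> bool" where
  "proper f \<longleftrightarrow> (\<forall>x. f x \<noteq> -\<infinity>) \<and> eff_dom f \<noteq> {}"

text \<open>Closed proper convex functions with values in the reals extended by \<open>\<infinity>\<close>;
  the value \<open>-\<infinity>\<close> of \<^typ>\<open>ereal\<close> is excluded by properness.\<close>

definition Gamma0 :: "('a::euclidean_space \<Rightarrow> ereal) set" where
  "Gamma0 = {f. proper f \<and> closed (epi f) \<and> convex (epi f)}"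

text \<open>For \<open>f \<in> Gamma0\<close> and \<open>l > 0\<close> the minimizer exists and is unique, so that the choice made
  by \<^const>\<open>arg_min\<close> is immaterial.\<close>

definition prox :: "real \<Rightarrow> ('a::euclidean_space \<Rightarrow> ereal) \<Rightarrow> 'a \<Rightarrow> 'a" where
  "prox l f x = arg_min (\<lambda>u. f u + ereal (1 / (2 * l) * (norm (x - u))\<^sup>2)) (\<lambda>u. True)"

text \<open>For proper \<open>f\<close>, the subdifferential is empty outside the effective domain.\<close>

definition subdifferential :: "('a::euclidean_space \<Rightarrow> ereal) \<Rightarrow> 'a \<Rightarrow> 'a set" where
  "subdifferential f x = {v. \<forall>y. f x + ereal (v \<bullet> (y - x)) \<le> f y}"

definition dom_subdifferential :: "('a::euclidean_space \<Rightarrow> ereal) \<Rightarrow> 'a set" where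
  "dom_subdifferential f = {x. subdifferential f x \<noteq> {}}"

definition eta :: "('a::euclidean_space \<Rightarrow> ereal) \<Rightarrow> 'a \<Rightarrow> real \<Rightarrow> ereal" where
  "eta f x l = (if l > 0 then f (prox l f x)
                else f (closest_point (closure (eff_dom f)) x))"

definition finite_on :: "'b set \<Rightarrow> ('b \<Rightarrow> ereal) \<Rightarrow> bool" where
  "finite_on S g \<longleftrightarrow> (\<forall>t\<in>S. \<bar>g t\<bar> \<noteq> \<infinity>)"

text \<open>Finiteness is required explicitly because \<^const>\<open>real_of_ereal\<close> maps infinite values to \<open>0\<close>.\<close>

definition locally_lipschitz_on :: "'b::metric_space set \<Rightarrow> ('b \<Rightarrow> ereal) \<Rightarrow> bool" where
  "locally_lipschitz_on S g \<longleftrightarrow> finite_on S g \<and>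
     (\<forall>t\<in>S. \<exists>e>0. \<exists>L. L-lipschitz_on (ball t e \<inter> S) (\<lambda>s. real_of_ereal (g s)))"

end

theory Submission
  imports Defs
begin

text \<open>
  Write \<open>p\<^sub>l\<close> for the proximal point with parameter \<open>l > 0\<close> and \<open>v\<^sub>l = (x - p\<^sub>l) / l\<close>, where \<open>x\<close> is
  the base point. The first-order condition says that \<open>v\<^sub>l\<close> is a subgradient of \<open>f\<close> at \<open>p\<^sub>l\<close>
  (\<open>prox_subgradient\<close>), and everything rests on this and on the comparison of the minimization
  problems for two parameters.

  Comparing the two problems shows that for \<open>0 < l \<le> m\<close> the distance \<open>norm (x - p\<^sub>l)\<close> increases
  with \<open>l\<close> while \<open>f p\<^sub>l\<close> decreases. Monotonicity of the subdifferential bounds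
  \<open>norm (p\<^sub>l - p\<^sub>m)\<close> by \<open>2 (m - l) norm v\<^sub>l\<close>, and the subgradient inequality at \<open>p\<^sub>l\<close> then yields
  \<open>f p\<^sub>l - f p\<^sub>m \<le> 2 (m - l) (norm v\<^sub>l)\<^sup>2\<close> (\<open>prox_value_diff_le\<close>). The vectors \<open>v\<^sub>l\<close> are locally
  bounded on the positive axis, which gives the local Lipschitz property there. If \<open>x\<close> has a
  subgradient \<open>v\<close>, then \<open>norm v\<^sub>l \<le> norm v\<close> for every \<open>l\<close>, and the Lipschitz bound extends to the
  whole line.

  Only continuity at \<open>0\<close> remains. Let \<open>p\<close> be the projection of \<open>x\<close> onto the closure of the domain.
  No \<open>p\<^sub>l\<close> is closer to \<open>x\<close> than \<open>p\<close>, so \<open>f p\<^sub>l \<le> f p\<close>. The points \<open>p\<^sub>l\<close> come arbitrarily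
  close to \<open>p\<close> (\<open>prox_near_closest_point\<close>), so closedness of the epigraph rules out that all values
  \<open>f p\<^sub>l\<close> stay below a number smaller than \<open>f p\<close>; by monotonicity this is continuity.
\<close>

section \<open>Functions in \<open>Gamma0\<close> on their domain\<close>

context
  fixes f :: "'a::euclidean_space \<Rightarrow> ereal"
  assumes f: "f \<in> Gamma0"
begin

text \<open>The finite values of \<open>f\<close>; outside the domain, the value \<open>0\<close> is meaningless.\<close>

abbreviation (input) F :: "'a \<Rightarrow> real" where
  "F y \<equiv> real_of_ereal (f y)"

lemma Gamma0_not_MInf: "f y \<noteq> -\<infinity>"
  using f by (auto simp: Gamma0_def proper_def)

lemma Gamma0_abs_finite: "y \<in> eff_dom f \<Longrightarrow> \<bar>f y\<bar> \<noteq> \<infinity>"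
  using Gamma0_not_MInf[of y] by (cases "f y") (auto simp: eff_dom_def)

lemma Gamma0_finite: "y \<in> eff_dom f \<Longrightarrow> f y = ereal (F y)"
  using Gamma0_abs_finite[of y] by (simp add: ereal_real')

lemma Gamma0_outside: "y \<notin> eff_dom f \<Longrightarrow> f y = \<infinity>"
  by (auto simp: eff_dom_def)

lemma Gamma0_dom_nonempty: "eff_dom f \<noteq> {}"
  using f by (auto simp: Gamma0_def proper_def)

lemma mem_epi_real: "y \<in> eff_dom f \<Longrightarrow> (y, r) \<in> epi f \<longleftrightarrow> F y \<le> r"
  using Gamma0_abs_finite[of y] by (simp add: epi_def real_le_ereal_iff)

lemma epi_imp_dom: "(y, r) \<in> epi f \<Longrightarrow> y \<in> eff_dom f"
  by (auto simp: epi_def eff_dom_def)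

lemma Gamma0_convex_combination:
  assumes "y \<in> eff_dom f" "z \<in> eff_dom f" "0 \<le> t" "t \<le> 1"
  shows "(1 - t) *\<^sub>R y + t *\<^sub>R z \<in> eff_dom f"
    and "F ((1 - t) *\<^sub>R y + t *\<^sub>R z) \<le> (1 - t) * F y + t * F z"
proof -
  have "convex (epi f)"
    using f by (simp add: Gamma0_def)
  moreover have "(y, F y) \<in> epi f" "(z, F z) \<in> epi f"
    using assms by (simp_all add: mem_epi_real)
  ultimately have "(1 - t) *\<^sub>R (y, F y) + t *\<^sub>R (z, F z) \<in> epi f"
    using assms by (intro convexD) auto
  then have *: "((1 - t) *\<^sub>R y + t *\<^sub>R z, (1 - t) * F y + t * F z) \<in> epi f"
    by simp
  then show dom: "(1 - t) *\<^sub>R y + t *\<^sub>R z \<in> eff_dom f"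
    by (rule epi_imp_dom)
  show "F ((1 - t) *\<^sub>R y + t *\<^sub>R z) \<le> (1 - t) * F y + t * F z"
    using * mem_epi_real[OF dom] by simp
qed

lemma convex_eff_dom: "convex (eff_dom f)"
  using Gamma0_convex_combination(1) by (auto simp: convex_alt)

text \<open>Separating a point strictly below the graph from the epigraph gives an affine minorant; the
  separating hyperplane is not vertical because the point lies directly below a point of the graph.\<close>

lemma Gamma0_affine_minorant:
  "\<exists>c w. \<forall>y r. (y, r) \<in> epi f \<longrightarrow> c + w \<bullet> y \<le> r"
proof -
  obtain x0 where x0: "x0 \<in> eff_dom f"
    using Gamma0_dom_nonempty by blast
  have "(x0, F x0 - 1) \<notin> epi f" and x0_epi: "(x0, F x0) \<in> epi f"
    using x0 by (simp_all add: mem_epi_real)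
  moreover have "closed (epi f)" "convex (epi f)"
    using f by (simp_all add: Gamma0_def)
  ultimately obtain a b where ab: "a \<bullet> (x0, F x0 - 1) < b" "\<And>z. z \<in> epi f \<Longrightarrow> b < a \<bullet> z"
    using separating_hyperplane_closed_point[of "epi f" "(x0, F x0 - 1)"] by blast
  obtain v s where a: "a = (v, s)"
    by fastforce
  have "v \<bullet> x0 + s * (F x0 - 1) < b" "b < v \<bullet> x0 + s * F x0"
    using ab(1) ab(2)[OF x0_epi] by (simp_all add: a)
  then have "s > 0"
    by (simp add: algebra_simps)
  show ?thesis
  proof (intro exI allI impI)
    fix y r assume "(y, r) \<in> epi f"
    then have "b < v \<bullet> y + s * r"
      using ab(2)[of "(y, r)"] by (simp add: a)
    then have "(b - v \<bullet> y) / s \<le> r"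
      using \<open>s > 0\<close> by (simp add: divide_simps mult.commute)
    then show "b / s + (- (1 / s) *\<^sub>R v) \<bullet> y \<le> r"
      by (simp add: diff_divide_distrib)
  qed
qed

section \<open>The proximal point\<close>

lemma ex_prox:
  assumes "l > 0"
  obtains p where "p \<in> eff_dom f"
    and "\<And>u. u \<in> eff_dom f \<Longrightarrow>
          F p + 1 / (2 * l) * (norm (x - p))\<^sup>2 \<le> F u + 1 / (2 * l) * (norm (x - u))\<^sup>2"
proof -
  define k where "k = 1 / (2 * l)"
  have k: "k > 0"
    using assms by (simp add: k_def)
  obtain x0 where x0: "x0 \<in> eff_dom f"
    using Gamma0_dom_nonempty by blast
  obtain c w where minorant: "\<And>y r. (y, r) \<in> epi f \<Longrightarrow> c + w \<bullet> y \<le> r"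
    using Gamma0_affine_minorant by blast
  \<comment> \<open>The objective is lifted to a continuous function on the epigraph, whose sublevel set at the
    level of a point above \<open>x0\<close> is compact.\<close>
  define g where "g z = snd z + k * (norm (x - fst z))\<^sup>2" for z :: "'a \<times> real"
  define K where "K = epi f \<inter> {z. g z \<le> g (x0, F x0)}"
  have cont: "continuous_on UNIV g"
    unfolding g_def by (intro continuous_intros)
  have "closed (epi f)"
    using f by (simp add: Gamma0_def)
  moreover have "closed {z. g z \<le> g (x0, F x0)}"
    using cont by (intro closed_Collect_le) auto
  ultimately have "closed K"
    by (auto simp: K_def)
  define M where "M = g (x0, F x0)"
  define B where "B = (M - c - w \<bullet> x + (norm w)\<^sup>2 / (2 * k)) * 2 / k"
  have norm_le: "(norm (x - y))\<^sup>2 \<le> B" and height: "c + w \<bullet> y \<le> r" "r \<le> M" if "(y, r) \<in> K" for y r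
  proof -
    show minor: "c + w \<bullet> y \<le> r"
      using minorant that by (auto simp: K_def)
    have le: "r + k * (norm (x - y))\<^sup>2 \<le> M"
      using that by (simp add: K_def g_def M_def)
    then show "r \<le> M"
      using k by (smt (verit) mult_nonneg_nonneg zero_le_power2)
    \<comment> \<open>Half of the quadratic term absorbs the linear term \<open>w \<bullet> (x - y)\<close>.\<close>
    have "0 \<le> k / 2 * (norm ((x - y) - (1 / k) *\<^sub>R w))\<^sup>2"
      using k by simp
    also have "\<dots> = k / 2 * (norm (x - y))\<^sup>2 - w \<bullet> (x - y) + (norm w)\<^sup>2 / (2 * k)"
    proof -
      have expand: "(norm (d - s *\<^sub>R w))\<^sup>2 = (norm d)\<^sup>2 - 2 * s * (w \<bullet> d) + s\<^sup>2 * (norm w)\<^sup>2" for d s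
        unfolding power2_norm_eq_inner
        by (simp add: inner_diff_left inner_diff_right inner_commute algebra_simps power2_eq_square)
      show ?thesis
        unfolding expand using k by (simp add: field_simps power2_eq_square)
    qed
    finally have "k / 2 * (norm (x - y))\<^sup>2 \<le> M - c - w \<bullet> x + (norm w)\<^sup>2 / (2 * k)"
      using le minor by (simp add: inner_diff_right)
    then show "(norm (x - y))\<^sup>2 \<le> B"
      using k by (simp add: B_def field_simps)
  qed
  have "bounded K"
  proof -
    have "K \<subseteq> cball x (sqrt B) \<times> cball 0 (\<bar>c\<bar> + norm w * (norm x + sqrt B) + \<bar>M\<bar>)"
    proof safe
      fix y r assume yr: "(y, r) \<in> K"
      have d: "norm (x - y) \<le> sqrt B"
        using norm_le[OF yr] real_le_rsqrt by blast
      then show "y \<in> cball x (sqrt B)"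
        by (simp add: dist_norm)
      have "norm y \<le> norm x + sqrt B"
        using d norm_triangle_sub[of y x] by (simp add: norm_minus_commute)
      then have "\<bar>w \<bullet> y\<bar> \<le> norm w * (norm x + sqrt B)"
        by (meson Cauchy_Schwarz_ineq2 mult_left_mono norm_ge_zero order_trans)
      then show "r \<in> cball 0 (\<bar>c\<bar> + norm w * (norm x + sqrt B) + \<bar>M\<bar>)"
        using height[OF yr] by (simp add: dist_norm)
    qed
    then show ?thesis
      using bounded_subset[OF bounded_Times[OF bounded_cball bounded_cball]] by blast
  qed
  have "compact K"
    using \<open>bounded K\<close> \<open>closed K\<close> by (simp add: compact_eq_bounded_closed)
  moreover have x0K: "(x0, F x0) \<in> K"
    using x0 by (simp add: K_def mem_epi_real)
  ultimately obtain z where z: "z \<in> K" "\<And>z'. z' \<in> K \<Longrightarrow> g z \<le> g z'"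
    using continuous_attains_inf[of K g] continuous_on_subset[OF cont] by blast
  obtain p r where pr: "z = (p, r)"
    by fastforce
  have p: "p \<in> eff_dom f"
    using z(1) by (auto simp: K_def pr intro: epi_imp_dom)
  have "F p \<le> r"
    using z(1) p by (simp add: K_def pr mem_epi_real)
  show thesis
  proof
    show "p \<in> eff_dom f" by fact
    fix u assume u: "u \<in> eff_dom f"
    have "g z \<le> g (u, F u)"
    proof (cases "(u, F u) \<in> K")
      case False
      then have "g (x0, F x0) \<le> g (u, F u)"
        using u by (simp add: K_def mem_epi_real)
      then show ?thesis
        using z(2)[OF x0K] by simp
    qed (rule z(2))
    then show "F p + 1 / (2 * l) * (norm (x - p))\<^sup>2 \<le> F u + 1 / (2 * l) * (norm (x - u))\<^sup>2"
      using \<open>F p \<le> r\<close> by (simp add: g_def pr k_def)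
  qed
qed

lemma
  assumes l: "l > 0"
  shows prox_in_dom: "prox l f x \<in> eff_dom f"
    and prox_minimal: "u \<in> eff_dom f \<Longrightarrow>
          F (prox l f x) + 1 / (2 * l) * (norm (x - prox l f x))\<^sup>2
            \<le> F u + 1 / (2 * l) * (norm (x - u))\<^sup>2"
proof -
  let ?g = "\<lambda>u. f u + ereal (1 / (2 * l) * (norm (x - u))\<^sup>2)"
  obtain p where p: "p \<in> eff_dom f" and min:
      "\<And>u. u \<in> eff_dom f \<Longrightarrow>
          F p + 1 / (2 * l) * (norm (x - p))\<^sup>2 \<le> F u + 1 / (2 * l) * (norm (x - u))\<^sup>2"
    using ex_prox[OF l] by metis
  have fin: "?g u = ereal (F u + 1 / (2 * l) * (norm (x - u))\<^sup>2)" if "u \<in> eff_dom f" for u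
    using Gamma0_finite[OF that] by (metis plus_ereal.simps(1))
  have "?g p \<le> ?g u" for u
  proof (cases "u \<in> eff_dom f")
    case True
    then show ?thesis
      unfolding fin[OF p] fin[OF True] using min[OF True] by simp
  qed (simp add: Gamma0_outside)
  then have "is_arg_min ?g (\<lambda>u. True) p"
    by (simp add: is_arg_min_linorder)
  then have "is_arg_min ?g (\<lambda>u. True) (prox l f x)"
    unfolding prox_def arg_min_def by (rule someI)
  then have le: "?g (prox l f x) \<le> ?g u" for u
    by (simp add: is_arg_min_linorder)
  show dom: "prox l f x \<in> eff_dom f"
  proof (rule ccontr)
    assume "prox l f x \<notin> eff_dom f"
    then show False
      using le[of p] unfolding fin[OF p] by (simp add: Gamma0_outside)
  qed
  show "F (prox l f x) + 1 / (2 * l) * (norm (x - prox l f x))\<^sup>2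
          \<le> F u + 1 / (2 * l) * (norm (x - u))\<^sup>2" if "u \<in> eff_dom f"
    using le[of u] unfolding fin[OF dom] fin[OF that] by simp
qed

text \<open>First-order optimality, obtained by comparing the proximal point with points on the segment
  to \<open>y\<close>.\<close>

lemma prox_subgradient:
  fixes x y :: 'a
  assumes l: "l > 0" and y: "y \<in> eff_dom f"
  defines "p \<equiv> prox l f x"
  shows "F p + ((1 / l) *\<^sub>R (x - p)) \<bullet> (y - p) \<le> F y"
proof -
  define c where "c = 1 / (2 * l) * (norm (y - p))\<^sup>2"
  define a where "a = F p + ((1 / l) *\<^sub>R (x - p)) \<bullet> (y - p) - F y"
  have bound: "a \<le> t * c" if t: "0 < t" "t < 1" for t
  proof -
    let ?z = "(1 - t) *\<^sub>R p + t *\<^sub>R y"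
    have p: "p \<in> eff_dom f"
      unfolding p_def by (rule prox_in_dom[OF l])
    have z: "?z \<in> eff_dom f" "F ?z \<le> (1 - t) * F p + t * F y"
      using Gamma0_convex_combination[OF p y, of t] t by auto
    have "F p + 1 / (2 * l) * (norm (x - p))\<^sup>2 \<le> F ?z + 1 / (2 * l) * (norm (x - ?z))\<^sup>2"
      using prox_minimal[OF l z(1)] by (simp add: p_def)
    moreover have "(norm (x - ?z))\<^sup>2
        = (norm (x - p))\<^sup>2 - 2 * t * ((x - p) \<bullet> (y - p)) + t\<^sup>2 * (norm (y - p))\<^sup>2"
      unfolding power2_norm_eq_inner
      by (simp add: inner_diff_left inner_diff_right inner_add_left inner_add_right inner_commute
          algebra_simps power2_eq_square)
    ultimately have "F p + 1 / (2 * l) * (norm (x - p))\<^sup>2 \<le> F ?z + 1 / (2 * l) *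
        ((norm (x - p))\<^sup>2 - 2 * t * ((x - p) \<bullet> (y - p)) + t\<^sup>2 * (norm (y - p))\<^sup>2)"
      by metis
    also have "\<dots> = F ?z + 1 / (2 * l) * (norm (x - p))\<^sup>2
        + 1 / (2 * l) * (t\<^sup>2 * (norm (y - p))\<^sup>2 - 2 * t * ((x - p) \<bullet> (y - p)))"
      by (simp only: ring_distribs)
    finally have "t * (F p - F y)
        \<le> 1 / (2 * l) * (t\<^sup>2 * (norm (y - p))\<^sup>2 - 2 * t * ((x - p) \<bullet> (y - p)))"
      using z(2) by (simp only: ring_distribs)
    also have "\<dots> = t * (t * c - ((1 / l) *\<^sub>R (x - p)) \<bullet> (y - p))"
      unfolding inner_scaleR_left using l by (simp add: c_def field_simps power2_eq_square)
    finally show ?thesis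
      using t by (simp add: a_def)
  qed
  have "((\<lambda>t. t * c) \<longlongrightarrow> 0 * c) (at_right 0)"
    by (intro tendsto_intros)
  moreover have "eventually (\<lambda>t. a \<le> t * c) (at_right 0)"
    unfolding eventually_at_right_field using bound by (intro exI[of _ 1]) auto
  ultimately have "a \<le> 0"
    using tendsto_lowerbound by fastforce
  then show ?thesis
    by (simp add: a_def)
qed

section \<open>Dependence on the parameter\<close>

lemma
  assumes "0 < l" "l \<le> m"
  shows norm_prox_mono: "norm (x - prox l f x) \<le> norm (x - prox m f x)"
    and prox_value_antimono: "F (prox m f x) \<le> F (prox l f x)"
proof -
  let ?p = "prox l f x" and ?q = "prox m f x"
  have m: "m > 0"
    using assms by simp
  have 1: "F ?p + 1 / (2 * l) * (norm (x - ?p))\<^sup>2 \<le> F ?q + 1 / (2 * l) * (norm (x - ?q))\<^sup>2"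
    and 2: "F ?q + 1 / (2 * m) * (norm (x - ?q))\<^sup>2 \<le> F ?p + 1 / (2 * m) * (norm (x - ?p))\<^sup>2"
    using prox_minimal prox_in_dom assms m by blast+
  have le: "(norm (x - ?p))\<^sup>2 \<le> (norm (x - ?q))\<^sup>2"
  proof (cases "l = m")
    case False
    then have "1 / (2 * l) - 1 / (2 * m) > 0"
      using assms by (simp add: field_simps)
    moreover have "(1 / (2 * l) - 1 / (2 * m)) * ((norm (x - ?p))\<^sup>2 - (norm (x - ?q))\<^sup>2) \<le> 0"
      using 1 2 by (simp add: algebra_simps)
    ultimately show ?thesis
      by (simp add: mult_le_0_iff)
  qed simp
  then show "norm (x - ?p) \<le> norm (x - ?q)"
    by (simp add: power2_le_iff_abs_le)
  have "1 / (2 * m) * (norm (x - ?p))\<^sup>2 \<le> 1 / (2 * m) * (norm (x - ?q))\<^sup>2"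
    using le m by (intro mult_left_mono) auto
  then show "F ?q \<le> F ?p"
    using 2 by linarith
qed

lemma prox_value_diff_le:
  assumes "0 < l" "l \<le> m"
  shows "F (prox l f x) - F (prox m f x) \<le> 2 * (m - l) * (norm ((1 / l) *\<^sub>R (x - prox l f x)))\<^sup>2"
proof -
  define p q where "p = prox l f x" and "q = prox m f x"
  define v w where "v = (1 / l) *\<^sub>R (x - p)" and "w = (1 / m) *\<^sub>R (x - q)"
  have m: "m > 0"
    using assms by simp
  have dom: "p \<in> eff_dom f" "q \<in> eff_dom f"
    unfolding p_def q_def using assms m prox_in_dom by auto
  have v: "F p + v \<bullet> (q - p) \<le> F q"
    using prox_subgradient[OF assms(1) dom(2), of x] by (simp add: p_def v_def)
  have w: "F q + w \<bullet> (p - q) \<le> F p"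
    using prox_subgradient[OF m dom(1), of x] by (simp add: q_def w_def)
  have "p = x - l *\<^sub>R v" "q = x - m *\<^sub>R w"
    using assms m by (simp_all add: v_def w_def)
  then have pq: "p - q = m *\<^sub>R (w - v) + (m - l) *\<^sub>R v"
    by (simp add: algebra_simps)
  have "m * (norm (v - w))\<^sup>2 = (m - l) * ((v - w) \<bullet> v) - (v - w) \<bullet> (p - q)"
    unfolding pq power2_norm_eq_inner
    by (simp add: inner_diff_left inner_diff_right inner_add_right inner_commute algebra_simps)
  also have "\<dots> \<le> (m - l) * ((v - w) \<bullet> v)"
    using v w by (simp add: inner_diff_left inner_diff_right)
  also have "\<dots> \<le> (m - l) * (norm (v - w) * norm v)"
    using assms by (intro mult_left_mono norm_cauchy_schwarz) auto
  finally have "norm (v - w) * (m * norm (v - w)) \<le> norm (v - w) * ((m - l) * norm v)"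
    by (simp add: power2_eq_square mult_ac)
  then have vw: "m * norm (v - w) \<le> (m - l) * norm v"
    using assms by (cases "v = w") (simp_all add: mult_le_cancel_left_pos)
  have "norm (p - q) \<le> m * norm (v - w) + (m - l) * norm v"
    unfolding pq using assms m norm_triangle_ineq[of "m *\<^sub>R (w - v)" "(m - l) *\<^sub>R v"]
    by (simp add: norm_minus_commute)
  then have pq_le: "norm (p - q) \<le> 2 * (m - l) * norm v"
    using vw by (simp add: algebra_simps)
  have "F p - F q \<le> v \<bullet> (p - q)"
    using v by (simp add: inner_diff_right)
  also have "\<dots> \<le> norm v * norm (p - q)"
    by (rule norm_cauchy_schwarz)
  also have "\<dots> \<le> norm v * (2 * (m - l) * norm v)"
    using pq_le by (intro mult_left_mono) auto
  finally show ?thesis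
    by (simp add: p_def q_def v_def power2_eq_square mult_ac)
qed

section \<open>Behaviour as the parameter tends to zero\<close>

lemma closest_point_closure_dom:
  "closest_point (closure (eff_dom f)) x \<in> closure (eff_dom f)"
  using Gamma0_dom_nonempty by (intro closest_point_in_set) auto

lemma closest_point_le_prox:
  "l > 0 \<Longrightarrow> norm (x - closest_point (closure (eff_dom f)) x) \<le> norm (x - prox l f x)"
  using closest_point_le[of "closure (eff_dom f)" "prox l f x" x] prox_in_dom[of l x] closure_subset
  by (fastforce simp: dist_norm)

lemma prox_value_le_closest_point:
  assumes l: "l > 0" and p: "closest_point (closure (eff_dom f)) x \<in> eff_dom f"
  shows "F (prox l f x) \<le> F (closest_point (closure (eff_dom f)) x)"
proof -
  have "1 / (2 * l) * (norm (x - closest_point (closure (eff_dom f)) x))\<^sup>2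
      \<le> 1 / (2 * l) * (norm (x - prox l f x))\<^sup>2"
    using l closest_point_le_prox[OF l] by (intro mult_left_mono power_mono) auto
  then show ?thesis
    using prox_minimal[OF l p, of x] by linarith
qed

lemma prox_near_closest_point:
  assumes "e > 0"
  shows "\<exists>l>0. dist (prox l f x) (closest_point (closure (eff_dom f)) x) < e"
proof -
  define p where "p = closest_point (closure (eff_dom f)) x"
  have "((\<lambda>u. (norm (x - u))\<^sup>2) \<longlongrightarrow> (norm (x - p))\<^sup>2) (nhds p)"
    by (intro tendsto_intros filterlim_ident)
  then have "eventually (\<lambda>u. (norm (x - u))\<^sup>2 < (norm (x - p))\<^sup>2 + e\<^sup>2 / 2) (nhds p)"
    using assms by (intro order_tendstoD(2)[where y = "(norm (x - p))\<^sup>2"]) auto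
  then obtain S where S: "open S" "p \<in> S" "\<And>u. u \<in> S \<Longrightarrow> (norm (x - u))\<^sup>2 < (norm (x - p))\<^sup>2 + e\<^sup>2 / 2"
    by (auto simp: eventually_nhds)
  moreover have "p \<in> closure (eff_dom f)"
    unfolding p_def by (rule closest_point_closure_dom)
  ultimately obtain u where u: "u \<in> eff_dom f" "(norm (x - u))\<^sup>2 < (norm (x - p))\<^sup>2 + e\<^sup>2 / 2"
    using open_Int_closure_eq_empty[of S "eff_dom f"] by blast
  \<comment> \<open>For \<open>l \<le> 1\<close>, monotonicity provides the lower bound \<open>f (prox 1 f x)\<close> of \<open>f (prox l f x)\<close>.\<close>
  define A where "A = \<bar>F u - F (prox 1 f x)\<bar> + 1"
  define l where "l = min 1 (e\<^sup>2 / (4 * A))"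
  have A: "A > 0"
    by (simp add: A_def)
  then have l: "l > 0" "l \<le> 1" "l * A \<le> e\<^sup>2 / 4"
    using assms by (auto simp: l_def min_def field_simps)
  let ?q = "prox l f x"
  have q: "?q \<in> closure (eff_dom f)"
    using prox_in_dom[OF l(1)] closure_subset by blast
  have "F ?q + 1 / (2 * l) * (norm (x - ?q))\<^sup>2 \<le> F u + 1 / (2 * l) * (norm (x - u))\<^sup>2"
    by (rule prox_minimal[OF l(1) u(1)])
  then have "1 / (2 * l) * (norm (x - ?q))\<^sup>2 \<le> A + 1 / (2 * l) * (norm (x - u))\<^sup>2"
    using prox_value_antimono[OF l(1,2), of x] by (simp add: A_def)
  then have "(norm (x - ?q))\<^sup>2 \<le> 2 * (l * A) + (norm (x - u))\<^sup>2"
    using l(1) by (simp add: field_simps)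
  then have "(norm (x - ?q))\<^sup>2 < (norm (x - p))\<^sup>2 + e\<^sup>2"
    using l(3) u(2) by simp
  moreover have "(norm (?q - p))\<^sup>2 \<le> (norm (x - ?q))\<^sup>2 - (norm (x - p))\<^sup>2"
  proof -
    \<comment> \<open>The variational inequality of the projection.\<close>
    have "(x - p) \<bullet> (?q - p) \<le> 0"
      unfolding p_def using convex_eff_dom q by (intro closest_point_dot convex_closure) auto
    moreover have "(norm (x - ?q))\<^sup>2 = (norm (x - p))\<^sup>2 - 2 * ((x - p) \<bullet> (?q - p)) + (norm (?q - p))\<^sup>2"
      unfolding power2_norm_eq_inner
      by (simp add: inner_diff_left inner_diff_right inner_commute algebra_simps)
    ultimately show ?thesis
      by simp
  qed
  ultimately have "(norm (?q - p))\<^sup>2 < e\<^sup>2"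
    by simp
  then have "norm (?q - p) < e"
    using assms by (simp add: power_less_imp_less_base)
  then show ?thesis
    using l(1) by (auto simp: p_def dist_norm)
qed

section \<open>The value function \<open>eta\<close>\<close>

lemma eta_pos: "l > 0 \<Longrightarrow> eta f x l = ereal (F (prox l f x))"
  using Gamma0_finite[OF prox_in_dom] by (simp add: eta_def)

lemma eta_nonpos: "l \<le> 0 \<Longrightarrow> eta f x l = f (closest_point (closure (eff_dom f)) x)"
  by (simp add: eta_def)

lemma antimono_eta: "antimono (eta f x)"
proof (rule antimonoI)
  fix l m :: real assume lm: "l \<le> m"
  consider "m \<le> 0" | "l \<le> 0" "m > 0" | "l > 0" by linarith
  then show "eta f x m \<le> eta f x l"
  proof cases
    case 1
    then show ?thesis
      using lm by (simp add: eta_nonpos)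
  next
    case 2
    show ?thesis
    proof (cases "closest_point (closure (eff_dom f)) x \<in> eff_dom f")
      case True
      then show ?thesis
        using 2 prox_value_le_closest_point[of m x] Gamma0_abs_finite
        by (simp add: eta_pos eta_nonpos ereal_le_real_iff)
    qed (use 2 in \<open>simp add: eta_nonpos Gamma0_outside\<close>)
  next
    case 3
    then show ?thesis
      using lm prox_value_antimono[of l m x] by (simp add: eta_pos)
  qed
qed

lemma finite_on_eta_iff:
  "finite_on UNIV (eta f x) \<longleftrightarrow> closest_point (closure (eff_dom f)) x \<in> eff_dom f"
proof
  assume "finite_on UNIV (eta f x)"
  then have "\<bar>eta f x 0\<bar> \<noteq> \<infinity>"
    by (auto simp: finite_on_def)
  then show "closest_point (closure (eff_dom f)) x \<in> eff_dom f"
    by (auto simp: eta_nonpos eff_dom_def)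
next
  assume p: "closest_point (closure (eff_dom f)) x \<in> eff_dom f"
  show "finite_on UNIV (eta f x)"
    unfolding finite_on_def
  proof
    fix l
    show "\<bar>eta f x l\<bar> \<noteq> \<infinity>"
      by (cases "l > 0") (simp_all add: eta_pos eta_nonpos Gamma0_abs_finite[OF p])
  qed
qed

text \<open>For a decreasing function, a one-sided estimate is enough for the Lipschitz property.\<close>

lemma lipschitz_on_eta:
  assumes fin: "finite_on S (eta f x)" and "L \<ge> 0"
    and bound: "\<And>l m. \<lbrakk>l \<in> S; m \<in> S; l < m\<rbrakk> \<Longrightarrow>
      real_of_ereal (eta f x l) - real_of_ereal (eta f x m) \<le> L * (m - l)"
  shows "L-lipschitz_on S (\<lambda>s. real_of_ereal (eta f x s))"
proof (rule lipschitz_onI)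
  have *: "dist (real_of_ereal (eta f x l)) (real_of_ereal (eta f x m)) \<le> L * dist l m"
    if "l \<in> S" "m \<in> S" "l < m" for l m
  proof -
    have "real_of_ereal (eta f x m) \<le> real_of_ereal (eta f x l)"
      using antimonoD[OF antimono_eta, of l m x] fin that
      by (auto simp: finite_on_def intro!: real_of_ereal_positive_mono real_le_ereal_iff[THEN iffD2])
    then show ?thesis
      using bound[OF that] that by (simp add: dist_real_def)
  qed
  fix l m assume "l \<in> S" "m \<in> S"
  then show "dist (real_of_ereal (eta f x l)) (real_of_ereal (eta f x m)) \<le> L * dist l m"
    using *[of l m] *[of m l] by (cases l m rule: linorder_cases) (simp_all add: dist_commute)
qed (fact \<open>L \<ge> 0\<close>)

lemma locally_lipschitz_on_eta_pos: "locally_lipschitz_on {0<..} (eta f x)"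
  unfolding locally_lipschitz_on_def
proof (intro conjI ballI)
  show fin: "finite_on {0<..} (eta f x)"
    by (simp add: finite_on_def eta_pos)
  fix t :: real assume "t \<in> {0<..}"
  then have t: "t > 0" by simp
  \<comment> \<open>Within distance \<open>t / 2\<close> of \<open>t\<close>, the proximal point is no farther from \<open>x\<close> than the one
    for the parameter \<open>2 * t\<close>.\<close>
  define V where "V = norm (x - prox (2 * t) f x) / (t / 2)"
  have "(2 * V\<^sup>2)-lipschitz_on (ball t (t / 2) \<inter> {0<..}) (\<lambda>s. real_of_ereal (eta f x s))"
  proof (rule lipschitz_on_eta)
    show "finite_on (ball t (t / 2) \<inter> {0<..}) (eta f x)"
      using fin by (auto simp: finite_on_def)
    fix l m assume "l \<in> ball t (t / 2) \<inter> {0<..}" "m \<in> ball t (t / 2) \<inter> {0<..}" and lm: "l < m"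
    then have l: "l > 0" "t / 2 \<le> l" "l \<le> 2 * t" and m: "m > 0"
      by (auto simp: dist_real_def abs_if split: if_splits)
    have "norm ((1 / l) *\<^sub>R (x - prox l f x)) = norm (x - prox l f x) / l"
      using l by simp
    also have "\<dots> \<le> V"
      unfolding V_def using l t norm_prox_mono[OF l(1,3), of x] by (intro frac_le) auto
    finally have "2 * (m - l) * (norm ((1 / l) *\<^sub>R (x - prox l f x)))\<^sup>2 \<le> 2 * (m - l) * V\<^sup>2"
      using lm by (intro mult_left_mono power_mono) auto
    then show "real_of_ereal (eta f x l) - real_of_ereal (eta f x m) \<le> 2 * V\<^sup>2 * (m - l)"
      using prox_value_diff_le[of l m x] l m lm unfolding eta_pos[OF l(1)] eta_pos[OF m]
      by (simp only: real_of_ereal.simps) argo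
  qed simp
  then show "\<exists>e>0. \<exists>L. L-lipschitz_on (ball t e \<inter> {0<..}) (\<lambda>s. real_of_ereal (eta f x s))"
    using t half_gt_zero by blast
qed

text \<open>The supremum of \<open>eta\<close> over the positive parameters is its value at \<open>0\<close>.\<close>

lemma eta_pos_exceeds:
  assumes "a < eta f x 0"
  shows "\<exists>l>0. a < eta f x l"
proof (rule ccontr)
  assume "\<not> ?thesis"
  then have le: "eta f x l \<le> a" if "l > 0" for l
    using that by (meson not_le)
  let ?p = "closest_point (closure (eff_dom f)) x"
  obtain r where r: "a = ereal r"
    using assms le[of 1] by (cases a) (auto simp: eta_pos)
  have "(?p, r) \<in> closure (epi f)"
    unfolding closure_approachable
  proof (intro allI impI)
    fix e :: real assume "e > 0"
    then obtain l where l: "l > 0" "dist (prox l f x) ?p < e"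
      using prox_near_closest_point by blast
    have "(prox l f x, r) \<in> epi f"
      using le[OF l(1)] l(1) by (simp add: eta_pos r mem_epi_real prox_in_dom)
    then show "\<exists>y\<in>epi f. dist y (?p, r) < e"
      using l(2) by (intro bexI[of _ "(prox l f x, r)"]) (simp_all add: dist_Pair_Pair)
  qed
  then have "f ?p \<le> a"
    using f by (simp add: Gamma0_def epi_def r)
  then show False
    using assms by (simp add: eta_nonpos)
qed

lemma continuous_on_eta: "continuous_on UNIV (eta f x)"
  unfolding continuous_on_eq_continuous_at[OF open_UNIV]
proof
  fix t :: real
  consider "t < 0" | "t = 0" | "t > 0" by linarith
  then show "isCont (eta f x) t"
  proof cases
    case 1
    then have "eventually (\<lambda>s. s < 0) (nhds t)"
      by (intro eventually_nhds_in_open[of "{..<0}", simplified]) auto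
    then have "eventually (\<lambda>s. eta f x s = f (closest_point (closure (eff_dom f)) x)) (nhds t)"
      by eventually_elim (simp add: eta_nonpos)
    then show ?thesis
      by (subst isCont_cong) auto
  next
    case 2
    have "(eta f x \<longlongrightarrow> eta f x 0) (at 0)"
    proof (rule order_tendstoI)
      fix a assume "a < eta f x 0"
      then obtain l where l: "l > 0" "a < eta f x l"
        using eta_pos_exceeds by blast
      then have "eventually (\<lambda>s. s < l) (at (0::real))"
        by (intro eventually_at_in_open'[of "{..<l}", simplified]) auto
      then show "eventually (\<lambda>s. a < eta f x s) (at 0)"
      proof eventually_elim
        case (elim s)
        then show ?case
          using l(2) antimonoD[OF antimono_eta, of s l x] by simp
      qed
    next
      fix a assume a: "eta f x 0 < a"
      have "eta f x s \<le> eta f x 0" for s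
        using antimonoD[OF antimono_eta, of 0 s x] by (cases "s \<ge> 0") (simp_all add: eta_nonpos)
      then show "eventually (\<lambda>s. eta f x s < a) (at 0)"
        using a by (intro always_eventually) (meson le_less_trans)
    qed
    then show ?thesis
      by (simp add: 2 isCont_def)
  next
    case 3
    then obtain e L where e: "e > 0"
      and L: "L-lipschitz_on (ball t e \<inter> {0<..}) (\<lambda>s. real_of_ereal (eta f x s))"
      using locally_lipschitz_on_eta_pos[of x] unfolding locally_lipschitz_on_def
      by (meson greaterThan_iff)
    have "continuous_on (ball t e \<inter> {0<..}) (\<lambda>s. ereal (real_of_ereal (eta f x s)))"
      using lipschitz_on_continuous_on[OF L] by (intro continuous_intros)
    then have "continuous_on (ball t e \<inter> {0<..}) (eta f x)"
      by (rule continuous_on_cong[THEN iffD1, rotated 2]) (simp_all add: eta_pos)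
    moreover have "open (ball t e \<inter> {0<..})" "t \<in> ball t e \<inter> {0<..}"
      using 3 e by auto
    ultimately show ?thesis
      using continuous_on_eq_continuous_at by blast
  qed
qed

text \<open>By monotonicity of the subdifferential, a subgradient at the base point bounds the proximal
  subgradients for all parameters.\<close>

lemma prox_subgradient_norm_le:
  assumes l: "l > 0" and x: "x \<in> eff_dom f"
    and v: "\<And>y. y \<in> eff_dom f \<Longrightarrow> F x + v \<bullet> (y - x) \<le> F y"
  shows "norm ((1 / l) *\<^sub>R (x - prox l f x)) \<le> norm v"
proof -
  define p where "p = prox l f x"
  define w where "w = (1 / l) *\<^sub>R (x - p)"
  have xp: "x - p = l *\<^sub>R w"
    using l by (simp add: w_def)
  have "F p + w \<bullet> (x - p) \<le> F x"
    using prox_subgradient[OF l x, of x] by (simp add: p_def w_def)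
  moreover have "F x \<le> F p + v \<bullet> (x - p)"
    using v[OF prox_in_dom[OF l, of x]] by (simp add: p_def inner_diff_right)
  ultimately have "w \<bullet> (x - p) \<le> v \<bullet> (x - p)"
    by simp
  then have "w \<bullet> w \<le> v \<bullet> w"
    unfolding xp using l by simp
  also have "\<dots> \<le> norm v * norm w"
    by (rule norm_cauchy_schwarz)
  finally have "norm w * norm w \<le> norm v * norm w"
    by (simp add: power2_norm_eq_inner flip: power2_eq_square)
  then have "norm w \<le> norm v"
    by (cases "w = 0") (simp_all add: mult_le_cancel_right)
  then show ?thesis
    by (simp add: w_def p_def)
qed

lemma locally_lipschitz_on_eta_UNIV:
  assumes "x \<in> dom_subdifferential f"
  shows "locally_lipschitz_on UNIV (eta f x)"
proof -
  obtain v where v: "\<And>y. f x + ereal (v \<bullet> (y - x)) \<le> f y"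
    using assms by (auto simp: dom_subdifferential_def subdifferential_def)
  have x: "x \<in> eff_dom f"
  proof (rule ccontr)
    assume nx: "x \<notin> eff_dom f"
    obtain y where "y \<in> eff_dom f"
      using Gamma0_dom_nonempty by blast
    then show False
      using v[of y] nx Gamma0_abs_finite[of y] by (simp add: Gamma0_outside)
  qed
  have vF: "F x + v \<bullet> (y - x) \<le> F y" if "y \<in> eff_dom f" for y
    using v[of y] Gamma0_finite[OF x] Gamma0_finite[OF that]
    by (metis ereal_less_eq(3) plus_ereal.simps(1))
  have px: "closest_point (closure (eff_dom f)) x = x"
    using x closure_subset by (intro closest_point_self) auto
  have fin: "finite_on UNIV (eta f x)"
    by (simp add: finite_on_eta_iff px x)
  have "(2 * (norm v)\<^sup>2)-lipschitz_on UNIV (\<lambda>s. real_of_ereal (eta f x s))"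
  proof (rule lipschitz_on_eta[OF fin])
    fix l m :: real assume lm: "l < m"
    consider "m \<le> 0" | "l \<le> 0" "m > 0" | "l > 0" by linarith
    then show "real_of_ereal (eta f x l) - real_of_ereal (eta f x m) \<le> 2 * (norm v)\<^sup>2 * (m - l)"
    proof cases
      case 1
      then show ?thesis
        using lm by (simp add: eta_nonpos)
    next
      case 2
      define w where "w = (1 / m) *\<^sub>R (x - prox m f x)"
      have w: "norm w \<le> norm v" "x - prox m f x = m *\<^sub>R w"
        using prox_subgradient_norm_le[OF 2(2) x vF] 2 by (simp_all add: w_def)
      have "F x - F (prox m f x) \<le> v \<bullet> (x - prox m f x)"
        using vF[OF prox_in_dom[OF 2(2), of x]] by (simp add: inner_diff_right)
      also have "\<dots> = m * (v \<bullet> w)"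
        by (simp add: w)
      also have "\<dots> \<le> m * (norm v * norm v)"
        using 2 order_trans[OF norm_cauchy_schwarz[of v w] mult_left_mono[OF w(1) norm_ge_zero]]
        by (intro mult_left_mono) auto
      also have "\<dots> \<le> (2 * (m - l)) * (norm v * norm v)"
        using 2 by (intro mult_right_mono) auto
      finally show ?thesis
        using 2 by (simp add: eta_pos eta_nonpos px power2_eq_square mult_ac)
    next
      case 3
      have "2 * (m - l) * (norm ((1 / l) *\<^sub>R (x - prox l f x)))\<^sup>2 \<le> 2 * (m - l) * (norm v)\<^sup>2"
        using lm prox_subgradient_norm_le[OF 3 x vF] by (intro mult_left_mono power_mono) auto
      then show ?thesis
        using prox_value_diff_le[of l m x] 3 lm unfolding eta_pos[OF 3] eta_pos[OF order.strict_trans[OF 3 lm]]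
        by (simp only: real_of_ereal.simps) argo
    qed
  qed simp
  then show ?thesis
    unfolding locally_lipschitz_on_def using fin lipschitz_on_subset zero_less_one by blast
qed

end

theorem corollary11:
  fixes f :: "'a::euclidean_space \<Rightarrow> ereal" and xbar :: 'a
  assumes "f \<in> Gamma0"
  shows
    "antimono (eta f xbar)
     \<and> continuous_on UNIV (eta f xbar)
     \<and> (closest_point (closure (eff_dom f)) xbar = xbar \<and> xbar \<in> eff_dom f
          \<longrightarrow> finite_on UNIV (eta f xbar))
     \<and> (finite_on UNIV (eta f xbar)
          \<longleftrightarrow> closest_point (closure (eff_dom f)) xbar \<in> eff_dom f)
     \<and> locally_lipschitz_on {0<..} (eta f xbar)
     \<and> (xbar \<in> dom_subdifferential f \<longrightarrow> locally_lipschitz_on UNIV (eta f xbar))"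
  using antimono_eta[OF assms] continuous_on_eta[OF assms] finite_on_eta_iff[OF assms]
    locally_lipschitz_on_eta_pos[OF assms] locally_lipschitz_on_eta_UNIV[OF assms]
  by simp

end
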